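(* Let $\{\zeta_x\}_{x\in\mathbb{Z}^2}$ be a collection of numbers in $[0,1]$, and define the environment $\omega=\{\omega_x\}_{x\in\mathbb{Z}^2}$ as follows. For $x\in\mathbb{Z}^2_{\mathrm{even}}$ set: if $d\in\{\mathbf{N},\mathbf{S}\}$, $\omega_x(d,\mathbf{F}(d))=\zeta_x$, $\omega_x(d,\mathbf{L}(d))=\omega_x(d,\mathbf{R}(d))=(1-\zeta_x)/2$, $\omega_x(d,\mathbf{B}(d))=0$; if $d\in\{\mathbf{W},\mathbf{E}\}$, $\omega_x(d,\mathbf{F}(d))=0$, $\omega_x(d,\mathbf{L}(d))=\omega_x(d,\mathbf{R}(d))=1/2$, $\omega_x(d,\mathbf{B}(d))=0$. For $x\in\mathbb{Z}^2_{\mathrm{odd}}$ and all $d\in\Delta$ set $\omega_x(d,\mathbf{F}(d))=0$, $\omega_x(d,\mathbf{L}(d))=\omega_x(d,\mathbf{R}(d))=1/2$, $\omega_x(d,\mathbf{B}(d))=0$. Suppose that $\zeta_x>0$ for at least one $x\in\mathbb{Z}^2_{\mathrm{even}}$. Then the recurrence of the persistent random walk in $\omega$ is determined by its initial condition $\xi=(x_0,d_0)\in\mathbb{Z}^2\times\Delta$. Namely, if $$x_0\in\mathbb{Z}^2_{\mathrm{even}},\ d_0\in\{\mathbf{E},\mathbf{W}\}\qquad\text{or}\qquad x_0\in\mathbb{Z}^2_{\mathrm{odd}},\ d_0\in\{\mathbf{N},\mathbf{S}\},$$ then the walk with initial condition $\xi$ is recurrent; otherwise it is non-recurrent. In either case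 the walk has zero asymptotic velocity, i.e. $\lim_{n\to+\infty}X_n/n=0$ $P^\omega_\xi$-almost surely.
   Context: Let $e_1=(1,0)$, $e_2=(0,1)$, $\Delta=\{\pm e_1,\pm e_2\}\subset\mathbb{Z}^2$, and write $\mathbf{E}=e_1$, $\mathbf{N}=e_2$, $\mathbf{W}=-e_1$, $\mathbf{S}=-e_2$. For $d\in\Delta$ let $d^\perp\in\Delta$ be such that $(d,d^\perp)$ has the same orientation as $(e_1,e_2)$ (counterclockwise rotation of $d$ by $90^\circ$), and set $\mathbf{R}(d)=-d^\perp$ (Right), $\mathbf{F}(d)=d$ (Forward), $\mathbf{L}(d)=d^\perp$ (Left), $\mathbf{B}(d)=-d$ (Backward). Set $\mathbb{Z}^2_{\mathrm{even}}=\{(x^1,x^2)\in\mathbb{Z}^2: x^1+x^2\in2\mathbb{Z}\}$ and $\mathbb{Z}^2_{\mathrm{odd}}=\mathbb{Z}^2\setminus\mathbb{Z}^2_{\mathrm{even}}$. An environment is a family $\omega=\{\omega_x\}_{x\in\mathbb{Z}^2}$ of $4\times4$ stochastic matrices $\omega_x=(\omega_x(d,d'))_{d,d'\in\Delta}$. Given $\omega$ and $\xi=(x_0,d_0)\in\mathbb{Z}^2\times\Delta$, the persistent random walk in $\omega$ with initial condition $\xi$ is the Markov chain $\{(X_n,D_n)\}_{n\ge0}$ on $\mathbb{Z}^2\times\Delta$ with law $P^\omega_\xi$ determined by $P^\omega_\xi\{(X_0,D_0)=(x_0,d_0)\}=1$ and $P^\omega_\xi\{(X_{n+1},D_{n+1})=(x',d')\mid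 (X_n,D_n)=(x,d)\}=\omega_x(d,d')$ if $x'=x+d'$, and $=0$ otherwise. The walk with initial condition $\xi$ is recurrent if $P^\omega_\xi\{(X_n,D_n)=\xi\text{ for some }n>0\}=1$, and non-recurrent if this probability is strictly less than $1$. *)

theory Defs
  imports "HOL-Probability.Probability" "HOL-Library.Product_Plus"
begin

type_synonym vec2 = "int \<times> int"
type_synonym state = "vec2 \<times> vec2"

definition East :: vec2 where "East = (1, 0)"
definition North :: vec2 where "North = (0, 1)"
definition West :: vec2 where "West = - East"
definition South :: vec2 where "South = - North"

definition directions :: "vec2 set" where
  "directions = {East, - East, North, - North}"

text \<open>Counterclockwise rotation by a right angle.\<close>
definition perp :: "vec2 \<Rightarrow> vec2" where
  "perp d = (- snd d, fst d)"

definition Right :: "vec2 \<Rightarrow> vec2" where "Right d = - perp d"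
definition Forward :: "vec2 \<Rightarrow> vec2" where "Forward d = d"
definition Left :: "vec2 \<Rightarrow> vec2" where "Left d = perp d"
definition Backward :: "vec2 \<Rightarrow> vec2" where "Backward d = - d"

definition Z2_even :: "vec2 set" where
  "Z2_even = {x. even (fst x + snd x)}"

definition Z2_odd :: "vec2 set" where
  "Z2_odd = UNIV - Z2_even"

text \<open>A matrix indexed by \<^const>\<open>directions\<close> is a function of two vectors; only its values at
  pairs of directions are meaningful.\<close>
type_synonym env = "vec2 \<Rightarrow> vec2 \<Rightarrow> vec2 \<Rightarrow> real"

definition environment :: "env \<Rightarrow> bool" where
  "environment \<omega> \<longleftrightarrow>
     (\<forall>x. \<forall>d\<in>directions. (\<forall>d'\<in>directions. 0 \<le> \<omega> x d d') \<and> (\<Sum>d'\<in>directions. \<omega> x d d') = 1)"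

definition transition :: "env \<Rightarrow> state \<Rightarrow> state \<Rightarrow> real" where
  "transition \<omega> s s' =
     (if snd s' \<in> directions \<and> fst s' = fst s + snd s' then \<omega> (fst s) (snd s) (snd s') else 0)"

text \<open>The law of the state following \<open>s\<close>. For an \<^const>\<open>environment\<close> and \<open>snd s \<in> directions\<close>
  its mass function is \<^const>\<open>transition\<close>; on other arguments it is some unspecified
  distribution.\<close>
definition step_pmf :: "env \<Rightarrow> state \<Rightarrow> state pmf" where
  "step_pmf \<omega> s = embed_pmf (transition \<omega> s)"

text \<open>The law of the state at time \<open>n\<close>, given the history \<open>h\<close> at the times before \<open>n\<close>.\<close>
definition walk_kernel :: "env \<Rightarrow> state \<Rightarrow> nat \<Rightarrow> (nat \<Rightarrow> state) \<Rightarrow> state measure" where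
  "walk_kernel \<omega> \<xi> n h =
     measure_pmf (if n = 0 then return_pmf \<xi> else step_pmf \<omega> (h (n - 1)))"

text \<open>The law of the walk started at \<open>\<xi>\<close>, as a measure on the space of trajectories
  \<open>p :: nat \<Rightarrow> state\<close>, with \<open>p n\<close> the pair of position and direction at time \<open>n\<close>: the
  projective limit provided by the Ionescu-Tulcea theorem. Lemmas \<open>walk_start\<close> and
  \<open>walk_markov\<close> below give its initial condition and Markov property.\<close>
definition walk_law :: "env \<Rightarrow> state \<Rightarrow> (nat \<Rightarrow> state) measure" where
  "walk_law \<omega> \<xi> =
     projective_family.lim UNIV
       (Ionescu_Tulcea.CI (walk_kernel \<omega> \<xi>) (\<lambda>_. count_space UNIV)) (\<lambda>_. count_space UNIV)"

definition return_prob :: "env \<Rightarrow> state \<Rightarrow> real" where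
  "return_prob \<omega> \<xi> = measure (walk_law \<omega> \<xi>) {p \<in> space (walk_law \<omega> \<xi>). \<exists>n>0. p n = \<xi>}"

definition recurrent :: "env \<Rightarrow> state \<Rightarrow> bool" where
  "recurrent \<omega> \<xi> \<longleftrightarrow> return_prob \<omega> \<xi> = 1"

definition non_recurrent :: "env \<Rightarrow> state \<Rightarrow> bool" where
  "non_recurrent \<omega> \<xi> \<longleftrightarrow> return_prob \<omega> \<xi> < 1"

definition to_real2 :: "vec2 \<Rightarrow> real \<times> real" where
  "to_real2 x = (real_of_int (fst x), real_of_int (snd x))"

definition zero_velocity :: "env \<Rightarrow> state \<Rightarrow> bool" where
  "zero_velocity \<omega> \<xi> \<longleftrightarrow>
     (AE p in walk_law \<omega> \<xi>. (\<lambda>n. (1 / real n) *\<^sub>R to_real2 (fst (p n))) \<longlonglongrightarrow> 0)"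

definition zeta_env :: "(vec2 \<Rightarrow> real) \<Rightarrow> env" where
  "zeta_env \<zeta> x d d' =
     (if x \<in> Z2_even \<and> d \<in> {North, South} then
        (if d' = Forward d then \<zeta> x
         else if d' = Left d \<or> d' = Right d then (1 - \<zeta> x) / 2
         else 0)
      else
        (if d' = Left d \<or> d' = Right d then 1 / 2 else 0))"


subsection \<open>The law of the walk is that of the intended Markov chain\<close>

lemma finite_directions [simp]: "finite directions"
  by (simp add: directions_def)

lemma turns_distinct:
  "d \<in> directions \<Longrightarrow> distinct [Forward d, Left d, Right d, Backward d]"
  by (auto simp: directions_def East_def North_def
      Left_def Right_def Forward_def Backward_def perp_def)

lemma directions_eq_turns:
  "d \<in> directions \<Longrightarrow> directions = {Forward d, Left d, Right d, Backward d}"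
  by (auto simp: directions_def East_def North_def
      Left_def Right_def Forward_def Backward_def perp_def)

lemma compass:
  "{North, South} \<subseteq> directions" "{West, East} \<subseteq> directions" "{North, South} \<inter> {West, East} = {}"
  by (auto simp: directions_def East_def North_def South_def West_def)

lemma zeta_env_even_NS:
  assumes "x \<in> Z2_even" "d \<in> {North, South}"
  shows "zeta_env \<zeta> x d (Forward d) = \<zeta> x"
    and "zeta_env \<zeta> x d (Left d) = (1 - \<zeta> x) / 2"
    and "zeta_env \<zeta> x d (Right d) = (1 - \<zeta> x) / 2"
    and "zeta_env \<zeta> x d (Backward d) = 0"
proof -
  have "distinct [Forward d, Left d, Right d, Backward d]"
    using turns_distinct compass(1) assms(2) by blast
  then show "zeta_env \<zeta> x d (Forward d) = \<zeta> x"
    and "zeta_env \<zeta> x d (Left d) = (1 - \<zeta> x) / 2"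
    and "zeta_env \<zeta> x d (Right d) = (1 - \<zeta> x) / 2"
    and "zeta_env \<zeta> x d (Backward d) = 0"
    unfolding zeta_env_def using assms by (simp_all only: simp_thms if_True if_False distinct.simps list.set insert_iff empty_iff) metis+
qed

lemma zeta_env_otherwise:
  assumes "x \<in> Z2_even \<and> d \<in> {West, East} \<or> x \<in> Z2_odd \<and> d \<in> directions"
  shows "zeta_env \<zeta> x d (Forward d) = 0"
    and "zeta_env \<zeta> x d (Left d) = 1 / 2"
    and "zeta_env \<zeta> x d (Right d) = 1 / 2"
    and "zeta_env \<zeta> x d (Backward d) = 0"
proof -
  have "\<not> (x \<in> Z2_even \<and> d \<in> {North, South})"
    using assms compass(3) unfolding Z2_odd_def by blast
  then have eq: "zeta_env \<zeta> x d d' = (if d' = Left d \<or> d' = Right d then 1 / 2 else 0)" for d'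
    unfolding zeta_env_def by (simp only: if_False)
  have "d \<in> directions"
    using assms compass(2) by blast
  from turns_distinct[OF this] show "zeta_env \<zeta> x d (Forward d) = 0"
    and "zeta_env \<zeta> x d (Left d) = 1 / 2"
    and "zeta_env \<zeta> x d (Right d) = 1 / 2"
    and "zeta_env \<zeta> x d (Backward d) = 0"
    unfolding eq by auto
qed

lemma environment_zeta_env:
  assumes "\<And>x. \<zeta> x \<in> {0..1}"
  shows "environment (zeta_env \<zeta>)"
  unfolding environment_def
proof (intro allI ballI conjI)
  fix x d d' assume d: "d \<in> directions"
  have \<zeta>: "0 \<le> \<zeta> x" "\<zeta> x \<le> 1" using assms[of x] by auto
  show "0 \<le> zeta_env \<zeta> x d d'"
    unfolding zeta_env_def using \<zeta> by simp
  have "(\<Sum>d'\<in>directions. zeta_env \<zeta> x d d') = zeta_env \<zeta> x d (Forward d) + zeta_env \<zeta> x d (Left d)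
      + zeta_env \<zeta> x d (Right d) + zeta_env \<zeta> x d (Backward d)"
    using turns_distinct[OF d] by (subst directions_eq_turns[OF d]) (simp add: add.assoc)
  also have "\<dots> = 1"
  proof (cases "x \<in> Z2_even \<and> d \<in> {North, South}")
    case True
    then show ?thesis using zeta_env_even_NS[of x d \<zeta>] by (simp add: field_simps)
  next
    case False
    with d have "x \<in> Z2_even \<and> d \<in> {West, East} \<or> x \<in> Z2_odd \<and> d \<in> directions"
      unfolding Z2_odd_def directions_def West_def South_def by blast
    from zeta_env_otherwise[OF this, of \<zeta>] show ?thesis by simp
  qed
  finally show "(\<Sum>d'\<in>directions. zeta_env \<zeta> x d d') = 1" .
qed

lemma pmf_step_pmf:
  assumes "environment \<omega>" "snd s \<in> directions"
  shows "pmf (step_pmf \<omega> s) s' = transition \<omega> s s'"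
  unfolding step_pmf_def
proof (rule pmf_embed_pmf)
  show nonneg: "0 \<le> transition \<omega> s u" for u
    using assms unfolding transition_def environment_def by (simp del: split_paired_All)
  let ?A = "(\<lambda>d'. (fst s + d', d')) ` directions"
  have "(\<integral>\<^sup>+ u. ennreal (transition \<omega> s u) \<partial>count_space UNIV)
      = (\<Sum>u\<in>?A. ennreal (transition \<omega> s u))"
    by (rule nn_integral_count_space'[of ?A]) (auto simp: transition_def image_iff)
  also have "\<dots> = ennreal (\<Sum>u\<in>?A. transition \<omega> s u)"
    using nonneg by (simp add: sum_ennreal)
  also have "(\<Sum>u\<in>?A. transition \<omega> s u) = (\<Sum>d'\<in>directions. \<omega> (fst s) (snd s) d')"
    by (subst sum.reindex) (auto simp: inj_on_def transition_def)
  also have "\<dots> = 1"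
    using assms unfolding environment_def by (simp del: split_paired_All)
  finally show "(\<integral>\<^sup>+ u. ennreal (transition \<omega> s u) \<partial>count_space UNIV) = 1" by simp
qed

interpretation walk: Ionescu_Tulcea "walk_kernel \<omega> \<xi>" "\<lambda>_. count_space UNIV" for \<omega> \<xi>
proof (rule Ionescu_Tulcea.intro)
  fix i :: nat
  have comp: "(\<lambda>h. h (i - 1)) \<in> measurable (PiM {0..<i} (\<lambda>_. count_space UNIV)) (count_space UNIV)"
    if "i \<noteq> 0"
    using that by (intro measurable_component_singleton) simp
  have "(\<lambda>s. measure_pmf (step_pmf \<omega> s)) \<in> measurable (count_space UNIV) (subprob_algebra (count_space UNIV))"
    by (auto simp: space_subprob_algebra intro!: measurable_count_space_eq1[THEN iffD2] prob_space_imp_subprob_space prob_space_measure_pmf)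
  from measurable_compose[OF comp this]
  show "walk_kernel \<omega> \<xi> i \<in> measurable (PiM {0..<i} (\<lambda>_. count_space UNIV)) (subprob_algebra (count_space UNIV))"
    unfolding walk_kernel_def[abs_def]
    by (cases "i = 0")
       (auto simp: space_subprob_algebra intro!: measurable_const prob_space_imp_subprob_space prob_space_measure_pmf)
next
  fix i :: nat and x :: "nat \<Rightarrow> state"
  show "prob_space (walk_kernel \<omega> \<xi> i x)"
    unfolding walk_kernel_def by (rule prob_space_measure_pmf)
qed

lemma sets_walk_law: "sets (walk_law \<omega> \<xi>) = sets (PiM UNIV (\<lambda>_. count_space UNIV))"
  unfolding walk_law_def by (rule walk.PF.sets_lim)

lemma space_walk_law [simp]: "space (walk_law \<omega> \<xi>) = UNIV"
  using sets_eq_imp_space_eq[OF sets_walk_law] by (simp add: space_PiM)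

lemma prob_space_walk_law: "prob_space (walk_law \<omega> \<xi>)"
proof
  have X: "{\<lambda>_::nat. undefined} \<in> sets (PiM {} (\<lambda>_. count_space UNIV :: state measure))"
    by (simp add: sets_PiM_empty)
  have "emeasure (walk_law \<omega> \<xi>) (prod_emb UNIV (\<lambda>_. count_space UNIV) {} {\<lambda>_::nat. undefined}) = 1"
    unfolding walk_law_def using walk.lim[OF _ X] prob_space.emeasure_space_1[OF walk.PF.prob_space_P, of "{}"]
    by (simp add: walk.PF.space_P space_PiM_empty)
  moreover have "prod_emb UNIV (\<lambda>_. count_space UNIV :: state measure) {} {\<lambda>_::nat. undefined} = UNIV"
    by (auto simp: prod_emb_def space_PiM restrict_def)
  ultimately show "emeasure (walk_law \<omega> \<xi>) (space (walk_law \<omega> \<xi>)) = 1"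
    by (simp only: space_walk_law)
qed

lemma walk_cylinder_emeasure:
  "emeasure (walk_law \<omega> \<xi>) {p. \<forall>k<n. p k = s k}
   = emeasure (walk.C \<omega> \<xi> 0 n (\<lambda>_. undefined)) (PiE {0..<n} (\<lambda>k. {s k}))"
proof -
  have X: "PiE {0..<n} (\<lambda>k. {s k}) \<in> sets (PiM {0..<n} (\<lambda>_. count_space UNIV))"
    by (intro sets_PiM_I_finite) auto
  have "{p. \<forall>k<n. p k = s k}
      = prod_emb UNIV (\<lambda>_. count_space UNIV) {0..<n} (PiE {0..<n} (\<lambda>k. {s k}))"
    by (auto simp: prod_emb_def PiE_iff space_PiM)
  then have "emeasure (walk_law \<omega> \<xi>) {p. \<forall>k<n. p k = s k}
      = emeasure (walk.CI \<omega> \<xi> {0..<n}) (PiE {0..<n} (\<lambda>k. {s k}))"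
    unfolding walk_law_def using walk.lim[OF _ X] by simp
  also have "\<dots> = emeasure (walk.C \<omega> \<xi> 0 n (\<lambda>_. undefined))
      (prod_emb {0..<n} (\<lambda>_. count_space UNIV) {0..<n} (PiE {0..<n} (\<lambda>k. {s k})))"
    by (rule walk.emeasure_CI[OF _ X]) simp
  also have "prod_emb {0..<n} (\<lambda>_. count_space UNIV) {0..<n} (PiE {0..<n} (\<lambda>k. {s k}))
      = PiE {0..<n} (\<lambda>k. {s k})"
    by (rule prod_emb_id) (auto simp: space_PiM PiE_iff)
  finally show ?thesis .
qed

lemma walk_cylinder_Suc:
  "measure (walk_law \<omega> \<xi>) {p. \<forall>k<Suc n. p k = s k}
   = measure (walk_law \<omega> \<xi>) {p. \<forall>k<n. p k = s k} * measure (walk_kernel \<omega> \<xi> n s) {s n}"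
proof -
  let ?M = "\<lambda>_. count_space UNIV :: state measure"
  let ?C = "walk.C \<omega> \<xi> 0 n (\<lambda>_. undefined)"
  let ?X = "\<lambda>n. PiE {0..<n} (\<lambda>k. {s k})"
  have X: "?X m \<in> sets (PiM {0..<m} ?M)" for m
    by (intro sets_PiM_I_finite) auto
  have spC: "space ?C = space (PiM {0..<n} ?M)" and seC: "sets ?C = sets (PiM {0..<n} ?M)"
    using walk.space_C[of "\<lambda>_. undefined" 0 \<omega> \<xi> n] walk.sets_C[of "\<lambda>_. undefined" 0 \<omega> \<xi> n]
    by auto
  have ne: "space ?C \<noteq> {}"
    unfolding spC by (simp add: space_PiM PiE_eq_empty_iff)
  have "emeasure (walk_law \<omega> \<xi>) {p. \<forall>k<Suc n. p k = s k} = emeasure (?C \<bind> walk.eP \<omega> \<xi> n) (?X (Suc n))"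
    by (simp add: walk_cylinder_emeasure)
  also have "\<dots> = (\<integral>\<^sup>+h. emeasure (walk.eP \<omega> \<xi> n h) (?X (Suc n)) \<partial>?C)"
  proof (rule emeasure_bind[OF ne _ X])
    show "walk.eP \<omega> \<xi> n \<in> measurable ?C (subprob_algebra (PiM {0..<Suc n} ?M))"
      using walk.measurable_eP[of \<omega> \<xi> n] by (simp add: measurable_cong_sets[OF seC refl])
  qed
  also have "\<dots> = (\<integral>\<^sup>+h. emeasure (walk_kernel \<omega> \<xi> n s) {s n} * indicator (?X n) h \<partial>?C)"
  proof (rule nn_integral_cong)
    fix h assume "h \<in> space ?C"
    then have h: "h \<in> space (PiM {0..<n} ?M)" by (simp add: spC)
    have "emeasure (walk.eP \<omega> \<xi> n h) (?X (Suc n))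
        = emeasure (walk_kernel \<omega> \<xi> n h) ((\<lambda>x. h(n := x)) -` ?X (Suc n) \<inter> UNIV)"
      using walk.emeasure_eP[OF h X] by simp
    also have "(\<lambda>x. h(n := x)) -` ?X (Suc n) \<inter> UNIV = (if h \<in> ?X n then {s n} else {})"
    proof -
      have "h(n := x) \<in> ?X (Suc n) \<longleftrightarrow> h \<in> ?X n \<and> x = s n" for x
        using h by (auto simp: PiE_iff space_PiM extensional_def less_Suc_eq Ball_def)
      then show ?thesis by (auto simp only: vimage_def Int_UNIV_right split: if_splits)
    qed
    also have "emeasure (walk_kernel \<omega> \<xi> n h) (if h \<in> ?X n then {s n} else {})
        = emeasure (walk_kernel \<omega> \<xi> n s) {s n} * indicator (?X n) h"
      by (auto simp: walk_kernel_def PiE_iff)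
    finally show "emeasure (walk.eP \<omega> \<xi> n h) (?X (Suc n))
        = emeasure (walk_kernel \<omega> \<xi> n s) {s n} * indicator (?X n) h" .
  qed
  also have "\<dots> = emeasure (walk_kernel \<omega> \<xi> n s) {s n} * emeasure ?C (?X n)"
    using X[of n] by (simp add: nn_integral_cmult_indicator seC)
  also have "emeasure ?C (?X n) = emeasure (walk_law \<omega> \<xi>) {p. \<forall>k<n. p k = s k}"
    by (simp add: walk_cylinder_emeasure)
  finally show ?thesis
    by (simp add: measure_def enn2real_mult mult.commute)
qed

lemma walk_start: "measure (walk_law \<omega> \<xi>) {p. p 0 = \<xi>} = 1"
proof -
  interpret prob_space "walk_law \<omega> \<xi>" by (rule prob_space_walk_law)
  show ?thesis
    using walk_cylinder_Suc[of \<omega> \<xi> 0 "\<lambda>_. \<xi>"] prob_space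
    by (simp add: walk_kernel_def measure_pmf_single)
qed

lemma walk_markov:
  assumes "environment \<omega>" "snd (s n) \<in> directions"
  shows "measure (walk_law \<omega> \<xi>) {p. (\<forall>k\<le>n. p k = s k) \<and> p (Suc n) = s'}
       = measure (walk_law \<omega> \<xi>) {p. \<forall>k\<le>n. p k = s k} * transition \<omega> (s n) s'"
proof -
  let ?s = "s(Suc n := s')"
  have "{p. (\<forall>k\<le>n. p k = s k) \<and> p (Suc n) = s'} = {p. \<forall>k<Suc (Suc n). p k = ?s k}"
    by (auto simp: less_Suc_eq_le le_Suc_eq)
  moreover have "{p. \<forall>k\<le>n. p k = s k} = {p. \<forall>k<Suc n. p k = ?s k}"
    by (auto simp: less_Suc_eq_le)
  moreover have "measure (walk_kernel \<omega> \<xi> (Suc n) ?s) {?s (Suc n)} = transition \<omega> (s n) s'"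
    using pmf_step_pmf[OF assms] by (simp add: walk_kernel_def measure_pmf_single)
  ultimately show ?thesis
    using walk_cylinder_Suc[of \<omega> \<xi> "Suc n" ?s] by simp
qed

end

theory Submission
  imports Defs
begin

text \<open>A turn switches both the parity of the site and the axis of motion. So there are two classes of
  states, distinguished by whether the arrivals at even sites are horizontal (\<open>recurrent_class\<close>) or
  vertical, and turns never lead from one to the other. Going straight is possible only at an even
  site that is entered vertically, and it leads from the second class into the first. Thus the first
  class is closed, and every trajectory goes straight at most once.

  In the first class the walk takes alternately horizontal and vertical steps with fair independent
  signs, so its coordinates are two independent simple random walks. A simple random walk is at the
  origin at time \<open>2 * m\<close> with probability of order \<open>1 / sqrt m\<close>, so the return probabilities of the
  pair are of order \<open>1 / m\<close>, their sum diverges, and the walk is recurrent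
  (\<open>recurrent_if_Green_diverges\<close>, \<open>recurrent_class_recurrent\<close>).

  From a state of the second class, the walk can reach by turns every even site, unless it comes
  to a site with \<open>\<zeta> > 0\<close> before. At the first such site it may go straight, after which it never leaves
  the first class. Rather than construct a path that avoids the starting state, the proof
  propagates the hypothetical certainty of hitting this state along the possible transitions
  (\<open>outside_recurrent_class_non_recurrent\<close>).

  For the velocity, turns have mean zero and the single straight step is bounded, so the exponential
  moments of the displacement in a coordinate direction at time \<open>n\<close> are at most a constant times
  \<open>cosh \<theta> ^ n\<close>. The tails of the displacement at scale \<open>n\<close> are therefore summable, and the
  Borel--Cantelli lemma applies (\<open>displacement_tail\<close>, \<open>displacement_sublinear\<close>).

  Everything about the law of the walk is derived from its decomposition at the first step
  (\<open>first_step\<close>) by induction on time.\<close>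

section \<open>Events on trajectories and the first step\<close>

abbreviation events :: "(nat \<Rightarrow> state) set set" where
  "events \<equiv> sets (PiM UNIV (\<lambda>_. count_space UNIV))"

definition cylinder :: "nat \<Rightarrow> (nat \<Rightarrow> state) \<Rightarrow> (nat \<Rightarrow> state) set" where
  "cylinder n s = {p. \<forall>k<n. p k = s k}"

abbreviation cylinders :: "(nat \<Rightarrow> state) set set" where
  "cylinders \<equiv> insert {} {cylinder n s |n s. True}"

lemma coordinate_measurable [measurable]:
  "(\<lambda>p. p n) \<in> measurable (PiM UNIV (\<lambda>_. count_space UNIV)) (count_space (UNIV :: state set))"
  by (rule measurable_component_singleton) simp

lemma coordinate_event [measurable]: "{p. P (p n)} \<in> events"
proof -
  have "(\<lambda>p. p n) -` {x. P x} \<inter> space (PiM UNIV (\<lambda>_. count_space (UNIV :: state set))) \<in> events"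
    by (rule measurable_sets[OF coordinate_measurable]) simp
  then show ?thesis by (simp add: space_PiM vimage_def)
qed

lemma UNIV_event [simp]: "UNIV \<in> events"
  using sets.top[of "PiM UNIV (\<lambda>_. count_space (UNIV :: state set))"] by (simp add: space_PiM)

lemma countable_visits_event:
  "{p. \<exists>n\<in>N. P (p n)} \<in> events" "{p. \<forall>n\<in>N. P (p n)} \<in> events" for N :: "nat set"
proof -
  show ex: "{p. \<exists>n\<in>N. P (p n)} \<in> events" for P
  proof -
    have "(\<Union>n\<in>N. {p. P (p n)}) \<in> events"
      by (intro sets.countable_UN') (auto intro: coordinate_event)
    moreover have "(\<Union>n\<in>N. {p. P (p n)}) = {p. \<exists>n\<in>N. P (p n)}" by blast
    ultimately show ?thesis by simp
  qed
  have "space (PiM UNIV (\<lambda>_. count_space (UNIV :: state set))) - {p. \<exists>n\<in>N. \<not> P (p n)} \<in> events"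
    by (rule sets.compl_sets[OF ex])
  moreover have "space (PiM UNIV (\<lambda>_. count_space (UNIV :: state set))) - {p. \<exists>n\<in>N. \<not> P (p n)}
      = {p. \<forall>n\<in>N. P (p n)}"
    by (auto simp: space_PiM)
  ultimately show "{p. \<forall>n\<in>N. P (p n)} \<in> events" by simp
qed

lemma shift_event:
  assumes "A \<in> events"
  shows "{p. (\<lambda>k. p (n + k)) \<in> A} \<in> events"
proof -
  have "(\<lambda>p k. p (n + k)) \<in> measurable (PiM UNIV (\<lambda>_. count_space UNIV)) (PiM UNIV (\<lambda>_. count_space (UNIV :: state set)))"
    by (rule measurable_PiM_single') (auto simp: space_PiM)
  from measurable_sets[OF this assms] show ?thesis
    by (simp add: space_PiM vimage_def)
qed

lemma Int_stable_cylinders: "Int_stable cylinders"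
proof -
  have le: "cylinder n s \<inter> cylinder m t \<in> cylinders" if "n \<le> m" for n m s t
  proof (cases "\<forall>k<n. s k = t k")
    case True
    with that have "cylinder n s \<inter> cylinder m t = cylinder m t"
      unfolding cylinder_def by fastforce
    then show ?thesis by blast
  next
    case False
    with that have "cylinder n s \<inter> cylinder m t = {}"
      unfolding cylinder_def by fastforce
    then show ?thesis by simp
  qed
  have "cylinder n s \<inter> cylinder m t \<in> cylinders" for n m s t
    using le[of n m s t] le[of m n t s] by (cases "n \<le> m") (simp_all add: Int_commute)
  then show ?thesis unfolding Int_stable_def by blast
qed

lemma cylinder_events: "cylinders \<subseteq> events"
proof -
  have "cylinder n s \<in> events" for n s
  proof -
    have "cylinder n s = (\<Inter>k\<in>{..<n}. {p. p k = s k})"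
      by (auto simp: cylinder_def)
    also have "\<dots> \<in> events"
      by (cases "n = 0") (auto intro!: sets.finite_INT coordinate_event)
    finally show ?thesis .
  qed
  then show ?thesis by auto
qed

text \<open>Since there are only countably many states, an event about one coordinate is a countable
  union of cylinders.\<close>
lemma cylinders_generate: "A \<in> events \<Longrightarrow> A \<in> sigma_sets UNIV cylinders"
proof -
  assume A: "A \<in> events"
  have "{p. p i \<in> B} \<in> sigma_sets UNIV cylinders" for i B
  proof -
    have "{p. p i \<in> B} = (\<Union>l\<in>{l. length l = Suc i \<and> l ! i \<in> B}. cylinder (Suc i) (\<lambda>k. l ! k))"
    proof (intro equalityI subsetI)
      fix p assume "p \<in> {p. p i \<in> B}"
      then have "map p [0..<Suc i] \<in> {l. length l = Suc i \<and> l ! i \<in> B}"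
        "p \<in> cylinder (Suc i) (\<lambda>k. map p [0..<Suc i] ! k)"
        by (auto simp: cylinder_def simp del: upt_Suc)
      then show "p \<in> (\<Union>l\<in>{l. length l = Suc i \<and> l ! i \<in> B}. cylinder (Suc i) (\<lambda>k. l ! k))"
        by blast
    qed (auto simp: cylinder_def)
    also have "\<dots> \<in> sigma_sets UNIV cylinders"
      by (rule sigma_sets_UNION) (auto intro!: sigma_sets.Basic)
    finally show ?thesis .
  qed
  then have "{{f \<in> PiE UNIV (\<lambda>i. space (count_space UNIV)). f i \<in> B} | i B.
      i \<in> UNIV \<and> B \<in> sets (count_space (UNIV :: state set))} \<subseteq> sigma_sets UNIV cylinders"
    by auto
  then have "sigma_sets UNIV {{f \<in> PiE UNIV (\<lambda>i. space (count_space UNIV)). f i \<in> B} | i B.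
      i \<in> UNIV \<and> B \<in> sets (count_space (UNIV :: state set))} \<subseteq> sigma_sets UNIV cylinders"
    by (rule sigma_sets_mono)
  with A show ?thesis unfolding sets_PiM_single by (auto simp: PiE_UNIV_domain)
qed

lemma AE_start: "AE p in walk_law \<omega> \<xi>. p 0 = \<xi>"
  using prob_space.AE_prob_1[OF prob_space_walk_law walk_start] by simp

lemma measure_walk_cong_start:
  assumes "A \<in> events" "B \<in> events" "\<And>p. p 0 = \<xi> \<Longrightarrow> p \<in> A \<longleftrightarrow> p \<in> B"
  shows "measure (walk_law \<omega> \<xi>) A = measure (walk_law \<omega> \<xi>) B"
  using AE_start[of \<xi> \<omega>] assms
  by (intro measure_eq_AE) (auto simp: sets_walk_law)

lemma cylinder_prob:
  "measure (walk_law \<omega> \<xi>) (cylinder (Suc n) s)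
    = (if s 0 = \<xi> then \<Prod>k<n. pmf (step_pmf \<omega> (s k)) (s (Suc k)) else 0)"
proof (induction n)
  case 0
  then show ?case
    using walk_cylinder_Suc[of \<omega> \<xi> 0 s] prob_space.prob_space[OF prob_space_walk_law, of \<omega> \<xi>]
    by (simp add: cylinder_def walk_kernel_def measure_pmf_single indicator_def)
next
  case (Suc n)
  then show ?case
    using walk_cylinder_Suc[of \<omega> \<xi> "Suc n" s]
    by (simp add: cylinder_def walk_kernel_def measure_pmf_single)
qed

text \<open>Both sides are probability measures in \<open>A\<close>, so it suffices to compare them on the cylinders,
  where each side is a product of transition probabilities.\<close>
lemma first_step:
  assumes env: "environment \<omega>" and d: "d \<in> directions" and A: "A \<in> events"
  shows "measure (walk_law \<omega> (x, d)) {p. (\<lambda>k. p (Suc k)) \<in> A}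
    = (\<Sum>d'\<in>directions. \<omega> x d d' * measure (walk_law \<omega> (x + d', d')) A)"
proof -
  let ?L = "walk_law \<omega>" and ?\<xi> = "(x, d)"
  let ?S = "\<lambda>A. {p :: nat \<Rightarrow> state. (\<lambda>k. p (Suc k)) \<in> A}"
  have total: "(\<Sum>d'\<in>directions. \<omega> x d d') = 1"
    using env d unfolding environment_def by (simp del: split_paired_All)
  interpret L: prob_space "?L s" for s by (rule prob_space_walk_law)
  have S: "?S A \<in> events" if "A \<in> events" for A
    using shift_event[OF that, of 1] by simp
  have ev: "B \<in> events" if "B \<in> sigma_sets UNIV cylinders" for B
    using that sets.sigma_sets_subset[OF cylinder_events] by (auto simp: space_PiM)
  have "cylinders \<subseteq> Pow UNIV" by simp
  from Int_stable_cylinders this cylinders_generate[OF A] show ?thesis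
  proof (induction A rule: sigma_sets_induct_disjoint)
    case (basic A)
    show ?case
    proof (cases "A = {}")
      case False
      then obtain n s where A: "A = cylinder n s" using basic by blast
      show ?thesis
      proof (cases n)
        case 0
        then have "A = UNIV" by (simp add: A cylinder_def)
        then show ?thesis using total L.prob_space by simp
      next
        case (Suc m)
        let ?t = "\<lambda>k. case k of 0 \<Rightarrow> ?\<xi> | Suc k \<Rightarrow> s k"
        have "measure (?L ?\<xi>) (?S A) = measure (?L ?\<xi>) (cylinder (Suc (Suc m)) ?t)"
        proof (rule measure_walk_cong_start)
          show "?S A \<in> events" using S cylinder_events A by auto
          show "cylinder (Suc (Suc m)) ?t \<in> events" using cylinder_events by auto
          fix p :: "nat \<Rightarrow> state" assume "p 0 = ?\<xi>"
          then show "p \<in> ?S A \<longleftrightarrow> p \<in> cylinder (Suc (Suc m)) ?t"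
            by (auto simp: A Suc cylinder_def All_less_Suc2)
        qed
        also have "\<dots> = pmf (step_pmf \<omega> ?\<xi>) (s 0) * (\<Prod>k<m. pmf (step_pmf \<omega> (s k)) (s (Suc k)))"
          unfolding cylinder_prob by (subst prod.lessThan_Suc_shift) simp
        also have "pmf (step_pmf \<omega> ?\<xi>) (s 0) = (\<Sum>d'\<in>directions. if s 0 = (x + d', d') then \<omega> x d d' else 0)"
        proof -
          have "(\<Sum>d'\<in>directions. if s 0 = (x + d', d') then \<omega> x d d' else 0)
            = (\<Sum>d'\<in>directions. if d' = snd (s 0) then (if fst (s 0) = x + d' then \<omega> x d d' else 0) else 0)"
            by (intro sum.cong) (auto simp: prod_eq_iff)
          also have "\<dots> = transition \<omega> ?\<xi> (s 0)"
            by (simp add: transition_def)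
          finally show ?thesis using pmf_step_pmf[OF env, of ?\<xi> "s 0"] d by simp
        qed
        finally show ?thesis
          unfolding A Suc cylinder_prob by (auto simp: sum_distrib_right intro!: sum.cong)
      qed
    qed simp
  next
    case empty
    then show ?case by simp
  next
    case (compl A)
    have A: "A \<in> events" by (rule ev[OF compl(1)])
    have "measure (?L ?\<xi>) (?S (UNIV - A)) = measure (?L ?\<xi>) (space (?L ?\<xi>) - ?S A)"
      by (rule arg_cong[where f = "measure _"]) auto
    also have "\<dots> = 1 - measure (?L ?\<xi>) (?S A)"
      using S[OF A] by (intro L.prob_compl) (simp add: sets_walk_law)
    also have "\<dots> = (\<Sum>d'\<in>directions. \<omega> x d d' * (1 - measure (?L (x + d', d')) A))"
      by (simp add: compl total right_diff_distrib sum_subtractf)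
    also have "\<dots> = (\<Sum>d'\<in>directions. \<omega> x d d' * measure (?L (x + d', d')) (UNIV - A))"
      using L.prob_compl[of A] A by (intro sum.cong refl) (simp add: sets_walk_law)
    finally show ?case .
  next
    case (union A)
    have A: "A i \<in> events" for i using union(2) ev by auto
    have "(\<lambda>i. measure (?L ?\<xi>) (?S (A i))) sums measure (?L ?\<xi>) (\<Union>i. ?S (A i))"
      using union(1) S[OF A]
      by (intro L.finite_measure_UNION) (auto simp: disjoint_family_on_def sets_walk_law)
    moreover have "(\<Union>i. ?S (A i)) = ?S (\<Union>i. A i)" by blast
    moreover have "(\<lambda>i. \<Sum>d'\<in>directions. \<omega> x d d' * measure (?L (x + d', d')) (A i)) sums
        (\<Sum>d'\<in>directions. \<omega> x d d' * measure (?L (x + d', d')) (\<Union>i. A i))"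
      using union(1) A
      by (intro sums_sum sums_mult L.finite_measure_UNION) (auto simp: sets_walk_law)
    ultimately show ?case
      unfolding union(3) using sums_unique2 by simp
  qed
qed

lemma first_step_coordinate:
  assumes "environment \<omega>" "d \<in> directions"
  shows "measure (walk_law \<omega> (x, d)) {p. P (p (Suc n))}
    = (\<Sum>d'\<in>directions. \<omega> x d d' * measure (walk_law \<omega> (x + d', d')) {p. P (p n)})"
  using first_step[OF assms coordinate_event[of P n], of x] by simp

lemma start_prob: "measure (walk_law \<omega> \<xi>) {p. P (p 0)} = (if P \<xi> then 1 else 0)"
proof -
  have "measure (walk_law \<omega> \<xi>) {p. P (p 0)} = measure (walk_law \<omega> \<xi>) {p. P \<xi>}"
    by (rule measure_walk_cong_start) (auto intro: coordinate_event coordinate_event[of "\<lambda>_. P \<xi>"])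
  then show ?thesis
    using prob_space.prob_space[OF prob_space_walk_law, of \<omega> \<xi>] by (cases "P \<xi>") auto
qed

section \<open>Divergence of the Green function implies recurrence\<close>

lemma markov_property:
  assumes env: "environment \<omega>" and d: "d \<in> directions" and A: "A \<in> events"
  shows "measure (walk_law \<omega> (x, d)) {p. p n = t \<and> (\<lambda>k. p (n + k)) \<in> A}
    = measure (walk_law \<omega> (x, d)) {p. p n = t} * measure (walk_law \<omega> t) A"
  using d
proof (induction n arbitrary: x d)
  case 0
  have "measure (walk_law \<omega> (x, d)) {p. p 0 = t \<and> (\<lambda>k. p (0 + k)) \<in> A}
      = measure (walk_law \<omega> (x, d)) (if (x, d) = t then A else {})"
    using sets.Int[OF coordinate_event[of "\<lambda>s. s = t" 0] A]
    by (intro measure_walk_cong_start) (auto simp: Int_def A)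
  then show ?case using start_prob[of \<omega> "(x, d)" "\<lambda>s. s = t"] by (auto split: if_splits)
next
  case (Suc n)
  let ?B = "{p. p n = t \<and> (\<lambda>k. p (n + k)) \<in> A}"
  have B: "?B \<in> events"
    using sets.Int[OF coordinate_event[of "\<lambda>s. s = t" n] shift_event[OF A, of n]]
    by (simp add: Int_def)
  have "measure (walk_law \<omega> (x, d)) {p. p (Suc n) = t \<and> (\<lambda>k. p (Suc n + k)) \<in> A}
      = (\<Sum>d'\<in>directions. \<omega> x d d' * measure (walk_law \<omega> (x + d', d')) ?B)"
    using first_step[OF env Suc.prems B, of x] by simp
  also have "\<dots> = (\<Sum>d'\<in>directions. \<omega> x d d' * measure (walk_law \<omega> (x + d', d')) {p. p n = t})
      * measure (walk_law \<omega> t) A"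
    using Suc.IH by (simp add: sum_distrib_right mult.assoc)
  finally show ?case
    using first_step_coordinate[OF env Suc.prems, of x "\<lambda>s. s = t" n] by simp
qed

text \<open>The events that time \<open>n\<close> is the last visit to the starting state are disjoint, and by the
  Markov property their probabilities are the terms of the Green function times the probability
  of no return. Hence their sum is finite only if the latter probability vanishes.\<close>
lemma recurrent_if_Green_diverges:
  assumes env: "environment \<omega>" and d: "d \<in> directions"
    and div: "\<not> summable (\<lambda>n. measure (walk_law \<omega> (x, d)) {p. p n = (x, d)})"
  shows "recurrent \<omega> (x, d)"
proof -
  let ?L = "walk_law \<omega> (x, d)"
  let ?N = "{p :: nat \<Rightarrow> state. \<forall>n\<in>{0<..}. p n \<noteq> (x, d)}"
  let ?E = "\<lambda>n. {p. p n = (x, d) \<and> (\<lambda>k. p (n + k)) \<in> ?N}"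
  interpret L: prob_space ?L by (rule prob_space_walk_law)
  have N: "?N \<in> events" by (rule countable_visits_event)
  have E: "?E n \<in> events" for n
    using sets.Int[OF coordinate_event[of "\<lambda>s. s = (x, d)" n] shift_event[OF N, of n]]
    by (simp add: Int_def)
  have "disjoint_family ?E"
    unfolding disjoint_family_on_def
  proof (intro ballI impI)
    have "?E i \<inter> ?E j = {}" if "i < j" for i j :: nat
    proof -
      have "p j \<noteq> (x, d)" if "(\<lambda>k. p (i + k)) \<in> ?N" for p
        using that \<open>i < j\<close> by (auto dest!: bspec[of _ _ "j - i"])
      then show ?thesis by blast
    qed
    note lt = this
    fix i j :: nat assume "i \<noteq> j"
    then consider "i < j" | "j < i" by linarith
    then show "?E i \<inter> ?E j = {}"
    proof cases
      case 2
      from lt[OF 2] show ?thesis by (subst Int_commute)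
    qed (rule lt)
  qed
  then have "(\<lambda>n. measure ?L (?E n)) sums measure ?L (\<Union>n. ?E n)"
    using E by (intro L.finite_measure_UNION) (auto simp: sets_walk_law)
  then have "summable (\<lambda>n. measure ?L {p. p n = (x, d)} * measure ?L ?N)"
    unfolding markov_property[OF env d N] by (rule sums_summable)
  with div have "measure ?L ?N = 0"
    using summable_mult2[of "\<lambda>n. measure ?L {p. p n = (x, d)} * measure ?L ?N" "1 / measure ?L ?N"]
    by (cases "measure ?L ?N = 0") auto
  then have "measure ?L (space ?L - ?N) = 1"
    using N by (subst L.prob_compl) (auto simp: sets_walk_law)
  moreover have "space ?L - ?N = {p \<in> space ?L. \<exists>n>0. p n = (x, d)}" by auto
  ultimately show ?thesis unfolding recurrent_def return_prob_def by simp
qed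


section \<open>The simple random walk on the integers\<close>

fun srw_prob :: "nat \<Rightarrow> int \<Rightarrow> real" where
  "srw_prob 0 z = (if z = 0 then 1 else 0)"
| "srw_prob (Suc n) z = (srw_prob n (z - 1) + srw_prob n (z + 1)) / 2"

lemma srw_prob_eq_0: "\<bar>z\<bar> > int n \<Longrightarrow> srw_prob n z = 0"
  by (induction n arbitrary: z) auto

lemma srw_prob_minus: "srw_prob n (- z) = srw_prob n z"
proof (induction n arbitrary: z)
  case (Suc n)
  then show ?case using Suc[of "z + 1"] Suc[of "z - 1"] by simp
qed simp

lemma srw_prob_binomial: "srw_prob n (2 * int k - int n) = real (n choose k) / 2 ^ n"
proof (induction n arbitrary: k)
  case 0
  then show ?case by (cases k) auto
next
  case (Suc n)
  show ?case
  proof (cases k)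
    case 0
    then show ?thesis using Suc[of 0] srw_prob_eq_0[of n "- int n - 2"] by (simp add: algebra_simps)
  next
    case (Suc j)
    have "2 * int k - int (Suc n) - 1 = 2 * int j - int n" "2 * int k - int (Suc n) + 1 = 2 * int k - int n"
      using Suc by auto
    then show ?thesis using Suc.IH[of j] Suc.IH[of k] Suc by (simp add: field_simps)
  qed
qed

lemma srw_prob_origin: "srw_prob (2 * m) 0 = real (2 * m choose m) / 4 ^ m"
  using srw_prob_binomial[of "2 * m" m] by (simp add: power_mult)

lemma srw_prob_origin_Suc:
  "srw_prob (2 * Suc m) 0 = srw_prob (2 * m) 0 * (real (2 * m + 1) / real (2 * m + 2))"
proof -
  have "real (2 * Suc m choose Suc m) = fact (2 * Suc m) / (fact (Suc m) * fact (Suc m))"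
    by (subst binomial_fact) auto
  also have "\<dots> = real (2 * m + 2) * real (2 * m + 1) * fact (2 * m) / (real (m + 1) * real (m + 1) * (fact m * fact m))"
    by (simp add: field_simps)
  also have "\<dots> = 4 * (real (2 * m + 1) / real (2 * m + 2)) * (fact (2 * m) / (fact m * fact m))"
    by (simp add: divide_simps) (simp add: algebra_simps)
  also have "fact (2 * m) / (fact m * fact m) = real (2 * m choose m)"
    by (subst binomial_fact) auto
  finally have "real (2 * Suc m choose Suc m)
      = 4 * (real (2 * m + 1) / real (2 * m + 2)) * real (2 * m choose m)" .
  moreover have "4 * b * c / 4 ^ Suc m = c / 4 ^ m * b" for b c :: real by simp
  ultimately show ?thesis by (simp only: srw_prob_origin)
qed

text \<open>The inequality for the square is stable under \<open>srw_prob_origin_Suc\<close> because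
  \<open>(2 * m + 1)\<^sup>2 \<ge> 2 * m * (2 * m + 2)\<close>. The square is also what occurs in the return probabilities of a
  pair of independent walks.\<close>
lemma srw_prob_origin_lower: "m > 0 \<Longrightarrow> (srw_prob (2 * m) 0)\<^sup>2 \<ge> 1 / (4 * real m)"
proof (induction m rule: nat_induct_non_zero)
  case 1
  then show ?case by (simp add: numeral_2_eq_2 power2_eq_square)
next
  case (Suc m)
  have "1 / (4 * real (Suc m)) \<le> 1 / (4 * real m) * (real (2 * m + 1) / real (2 * m + 2))\<^sup>2"
    using Suc.hyps by (simp add: divide_simps power2_eq_square) (simp add: algebra_simps)
  also have "\<dots> \<le> (srw_prob (2 * m) 0)\<^sup>2 * (real (2 * m + 1) / real (2 * m + 2))\<^sup>2"
    by (intro mult_right_mono Suc.IH) simp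
  finally show ?case unfolding srw_prob_origin_Suc power_mult_distrib .
qed

section \<open>The two classes of states\<close>

definition recurrent_class :: "state set" where
  "recurrent_class = {(x, d). x \<in> Z2_even \<and> d \<in> {East, West} \<or> x \<in> Z2_odd \<and> d \<in> {North, South}}"

definition may_go_straight :: "vec2 \<Rightarrow> vec2 \<Rightarrow> bool" where
  "may_go_straight x d \<longleftrightarrow> x \<in> Z2_even \<and> d \<in> {North, South}"

lemma perp_directions: "d \<in> directions \<Longrightarrow> perp d \<in> directions" "d \<in> directions \<Longrightarrow> - d \<in> directions"
proof -
  have "perp East = North" "perp North = - East" "perp (- d) = - perp d" for d
    by (simp_all add: perp_def East_def North_def prod_eq_iff)
  then show "d \<in> directions \<Longrightarrow> perp d \<in> directions"
    unfolding directions_def by (elim insertE emptyE) simp_all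
  show "d \<in> directions \<Longrightarrow> - d \<in> directions"
    unfolding directions_def by (elim insertE emptyE) simp_all
qed

lemma sum_turns:
  assumes "d \<in> directions"
  shows "(\<Sum>d'\<in>directions. f d') = f d + f (perp d) + f (- perp d) + f (- d)"
  using turns_distinct[OF assms] unfolding directions_eq_turns[OF assms]
  by (simp add: Forward_def Left_def Right_def Backward_def add.assoc)

lemma turn_sum:
  assumes "d \<in> directions" "\<not> may_go_straight x d"
  shows "(\<Sum>d'\<in>directions. zeta_env \<zeta> x d d' * g d') = (g (perp d) + g (- perp d)) / 2"
proof -
  have "x \<in> Z2_even \<and> d \<in> {West, East} \<or> x \<in> Z2_odd \<and> d \<in> directions"
    using assms by (auto simp: may_go_straight_def Z2_odd_def directions_def West_def South_def)
  note z = zeta_env_otherwise[OF this, of \<zeta>, unfolded Forward_def Left_def Right_def Backward_def]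
  show ?thesis unfolding sum_turns[OF assms(1)] z by simp
qed

lemma straight_sum:
  assumes "d \<in> directions" "may_go_straight x d"
  shows "(\<Sum>d'\<in>directions. zeta_env \<zeta> x d d' * g d')
    = \<zeta> x * g d + (1 - \<zeta> x) * ((g (perp d) + g (- perp d)) / 2)"
proof -
  have "x \<in> Z2_even" "d \<in> {North, South}" using assms(2) by (simp_all add: may_go_straight_def)
  note z = zeta_env_even_NS[OF this, of \<zeta>, unfolded Forward_def Left_def Right_def Backward_def]
  show ?thesis unfolding sum_turns[OF assms(1)] z by (simp add: distrib_left add_divide_distrib)
qed

lemma horizontal_iff: "d \<in> directions \<Longrightarrow> d \<in> {East, West} \<longleftrightarrow> snd d = 0"
  unfolding directions_def East_def North_def West_def by (elim insertE emptyE) simp_all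

lemma vertical_iff: "d \<in> directions \<Longrightarrow> d \<in> {North, South} \<longleftrightarrow> snd d \<noteq> 0"
  unfolding directions_def East_def North_def South_def by (elim insertE emptyE) simp_all

lemma recurrent_class_iff:
  assumes "d \<in> directions"
  shows "(x, d) \<in> recurrent_class \<longleftrightarrow> (even (fst x + snd x) \<longleftrightarrow> snd d = 0)"
  unfolding recurrent_class_def mem_Collect_eq case_prod_conv horizontal_iff[OF assms] vertical_iff[OF assms]
  unfolding Z2_even_def Z2_odd_def by blast

lemma may_go_straight_iff:
  assumes "d \<in> directions"
  shows "may_go_straight x d \<longleftrightarrow> even (fst x + snd x) \<and> snd d \<noteq> 0"
  unfolding may_go_straight_def vertical_iff[OF assms] by (simp add: Z2_even_def)

lemma turn_preserves_class:
  assumes "d \<in> directions" "d' \<in> {perp d, - perp d}"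
  shows "(x + d', d') \<in> recurrent_class \<longleftrightarrow> (x, d) \<in> recurrent_class"
proof -
  have d': "d' \<in> directions"
    using assms(2) perp_directions(1)[OF assms(1)] perp_directions(2)[of "perp d"] by blast
  have "odd (fst d' + snd d')" "snd d' = 0 \<longleftrightarrow> snd d \<noteq> 0"
    using assms by (auto simp: directions_def perp_def East_def North_def)
  moreover have "fst (x + d') + snd (x + d') = (fst x + snd x) + (fst d' + snd d')" by simp
  ultimately show ?thesis
    unfolding recurrent_class_iff[OF assms(1)] recurrent_class_iff[OF d'] by (simp only: even_add) blast
qed

lemma may_go_straight_direction: "may_go_straight x d \<Longrightarrow> d \<in> directions"
  using compass(1) unfolding may_go_straight_def by blast

lemma straight_enters_class:
  assumes "may_go_straight x d"
  shows "(x + d, d) \<in> recurrent_class"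
proof -
  note d = may_go_straight_direction[OF assms]
  have "odd (fst d + snd d)" using d by (auto simp: directions_def East_def North_def)
  moreover have "fst (x + d) + snd (x + d) = (fst x + snd x) + (fst d + snd d)" by simp
  ultimately show ?thesis
    using assms unfolding recurrent_class_iff[OF d] may_go_straight_iff[OF d] by (simp only: even_add) blast
qed

lemma recurrent_class_turns:
  assumes "(x, d) \<in> recurrent_class"
  shows "d \<in> directions \<and> \<not> may_go_straight x d"
proof -
  have d: "d \<in> directions"
    using assms compass unfolding recurrent_class_def by blast
  with assms show ?thesis by (simp add: recurrent_class_iff may_go_straight_iff)
qed

lemma zeta_environment: "\<forall>x. \<zeta> x \<in> {0..1} \<Longrightarrow> environment (zeta_env \<zeta>)"
  by (intro environment_zeta_env) blast

lemma recurrent_class_first_step: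
  assumes "\<forall>x. \<zeta> x \<in> {0..1}" "(x, d) \<in> recurrent_class"
  shows "measure (walk_law (zeta_env \<zeta>) (x, d)) {p. P (p (Suc n))}
    = (measure (walk_law (zeta_env \<zeta>) (x + perp d, perp d)) {p. P (p n)}
       + measure (walk_law (zeta_env \<zeta>) (x - perp d, - perp d)) {p. P (p n)}) / 2"
proof -
  have d: "d \<in> directions" "\<not> may_go_straight x d" using recurrent_class_turns[OF assms(2)] by auto
  show ?thesis
    using first_step_coordinate[OF zeta_environment[OF assms(1)] d(1), where x = x and P = P and n = n]
    by (simp add: turn_sum[OF d])
qed

section \<open>Recurrence inside the closed class\<close>

definition dot :: "vec2 \<Rightarrow> vec2 \<Rightarrow> int" where
  "dot u v = fst u * fst v + snd u * snd v"

lemma dot_add: "dot u (v + w) = dot u v + dot u w" "dot u (v - w) = dot u v - dot u w"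
  by (simp_all add: dot_def algebra_simps)

text \<open>Inside the class the walk alternates between steps along \<open>d0\<close> and steps along \<open>perp d0\<close>, all
  signs being independent and fair. The number of steps along \<open>d0\<close> is reduced by one and an extra
  factor \<open>1 / 2\<close> appears because the last step has to be \<open>d0\<close> itself.\<close>
lemma target_prob_in_class:
  fixes x0 :: vec2
  assumes \<zeta>: "\<forall>x. \<zeta> x \<in> {0..1}" and d0: "d0 \<in> directions" and s: "(x, d) \<in> recurrent_class"
    and d: "d \<in> {d0, - d0}"
  shows "measure (walk_law (zeta_env \<zeta>) (x, d)) {p. p (Suc (Suc (2 * n))) = (x0, d0)}
      = srw_prob (Suc n) (dot (perp d0) (x0 - x)) * srw_prob n (dot d0 (x0 - x) - 1) / 2"
proof -
  let ?P = "\<lambda>x d n. measure (walk_law (zeta_env \<zeta>) (x, d)) {p. p n = (x0, d0)}"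
  let ?D = "\<lambda>x. dot d0 (x0 - x) - 1" and ?D' = "\<lambda>x. dot (perp d0) (x0 - x)"
  note step = recurrent_class_first_step[OF \<zeta>, where P = "\<lambda>s. s = (x0, d0)"]
  have perp_perp: "perp (perp d0) = - d0" "perp (- perp d0) = d0" "perp (- d0) = - perp d0"
    by (simp_all add: perp_def prod_eq_iff)
  have dots: "dot d0 d0 = 1" "dot (perp d0) (perp d0) = 1" "dot d0 (perp d0) = 0" "dot (perp d0) d0 = 0"
    using d0 by (auto simp: dot_def directions_def perp_def East_def North_def)
  have dd: "d0 \<noteq> - d0" using d0 by (auto simp: directions_def East_def North_def)
  have shift: "?D (x + d0) = ?D x - 1" "?D' (x + d0) = ?D' x" "?D (x - d0) = ?D x + 1" "?D' (x - d0) = ?D' x"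
    "?D (x + perp d0) = ?D x" "?D' (x + perp d0) = ?D' x - 1"
    "?D (x - perp d0) = ?D x" "?D' (x - perp d0) = ?D' x + 1" for x
    by (simp_all add: dot_add dots)
  have orth: "?P x d (Suc m) = (?P (x + d0) d0 m + ?P (x - d0) (- d0) m) / 2"
    and class_orth: "(x + d0, d0) \<in> recurrent_class" "(x - d0, - d0) \<in> recurrent_class"
    if "(x, d) \<in> recurrent_class" "d \<in> {perp d0, - perp d0}" for x d m
    using step[OF that(1), where n = m] that(2) perp_perp
      turn_preserves_class[of d d0 x] turn_preserves_class[of d "- d0" x] that
      recurrent_class_turns[OF that(1)] by auto
  have par: "?P x d (Suc m) = (?P (x + perp d0) (perp d0) m + ?P (x - perp d0) (- perp d0) m) / 2"
    and class_par: "(x + perp d0, perp d0) \<in> recurrent_class" "(x - perp d0, - perp d0) \<in> recurrent_class"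
    if "(x, d) \<in> recurrent_class" "d \<in> {d0, - d0}" for x d m
    using step[OF that(1), where n = m] that(2) perp_perp
      turn_preserves_class[of d "perp d0" x] turn_preserves_class[of d "- perp d0" x] that
      recurrent_class_turns[OF that(1)] by auto
  let ?orth_law = "\<lambda>n. \<forall>x. \<forall>d\<in>{perp d0, - perp d0}. (x, d) \<in> recurrent_class \<longrightarrow>
      ?P x d (Suc (2 * n)) = srw_prob n (?D' x) * srw_prob n (?D x) / 2"
  have par_law: "?P x d (Suc (Suc (2 * n))) = srw_prob (Suc n) (?D' x) * srw_prob n (?D x) / 2"
    if law: "?orth_law n" and xd: "(x, d) \<in> recurrent_class" "d \<in> {d0, - d0}" for x d n
  proof -
    have "?P (x + perp d0) (perp d0) (Suc (2 * n)) = srw_prob n (?D' x - 1) * srw_prob n (?D x) / 2"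
      using law[rule_format, OF _ class_par(1)[OF xd]] unfolding shift by simp
    moreover have "?P (x - perp d0) (- perp d0) (Suc (2 * n)) = srw_prob n (?D' x + 1) * srw_prob n (?D x) / 2"
      using law[rule_format, OF _ class_par(2)[OF xd]] unfolding shift by simp
    ultimately show ?thesis
      unfolding par[OF xd] by (simp add: field_simps)
  qed
  have orth_law: "?orth_law n" for n
  proof (induction n)
    case 0
    have "?P x d (Suc (2 * 0)) = srw_prob 0 (?D' x) * srw_prob 0 (?D x) / 2"
      if xd: "(x, d) \<in> recurrent_class" "d \<in> {perp d0, - perp d0}" for x d
    proof -
      have "x + d0 = x0 \<longleftrightarrow> ?D' x = 0 \<and> ?D x = 0"
        using d0 by (cases x; cases x0) (auto simp: dot_def directions_def perp_def East_def North_def)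
      then have "?P (x + d0) d0 0 = srw_prob 0 (?D' x) * srw_prob 0 (?D x)"
        using start_prob[of "zeta_env \<zeta>" "(x + d0, d0)" "\<lambda>s. s = (x0, d0)"] by simp
      moreover have "?P (x - d0) (- d0) 0 = 0"
        using start_prob[of "zeta_env \<zeta>" "(x - d0, - d0)" "\<lambda>s. s = (x0, d0)"] dd by simp
      ultimately show ?thesis using orth[OF xd, of "2 * 0"] by simp
    qed
    then show ?case by blast
  next
    case (Suc n)
    have "?P x d (Suc (2 * Suc n)) = srw_prob (Suc n) (?D' x) * srw_prob (Suc n) (?D x) / 2"
      if xd: "(x, d) \<in> recurrent_class" "d \<in> {perp d0, - perp d0}" for x d
    proof -
      have "?P (x + d0) d0 (Suc (Suc (2 * n))) = srw_prob (Suc n) (?D' x) * srw_prob n (?D x - 1) / 2"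
        using par_law[OF Suc class_orth(1)[OF xd]] unfolding shift by simp
      moreover have "?P (x - d0) (- d0) (Suc (Suc (2 * n))) = srw_prob (Suc n) (?D' x) * srw_prob n (?D x + 1) / 2"
        using par_law[OF Suc class_orth(2)[OF xd]] unfolding shift by simp
      ultimately show ?thesis
        using orth[OF xd, of "Suc (Suc (2 * n))"] by (simp add: field_simps)
    qed
    then show ?case by blast
  qed
  show ?thesis by (rule par_law[OF orth_law s d])
qed

text \<open>At time \<open>4 * m\<close> both coordinates have made \<open>2 * m\<close> steps, so the probability of return is half
  the squared return probability of the simple random walk, at least \<open>1 / (8 * m)\<close>.\<close>
lemma recurrent_class_recurrent:
  assumes \<zeta>: "\<forall>x. \<zeta> x \<in> {0..1}" and s: "(x, d) \<in> recurrent_class"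
  shows "recurrent (zeta_env \<zeta>) (x, d)"
proof (rule recurrent_if_Green_diverges[OF zeta_environment[OF \<zeta>]])
  show d: "d \<in> directions" using recurrent_class_turns[OF s] by blast
  let ?u = "\<lambda>n. measure (walk_law (zeta_env \<zeta>) (x, d)) {p. p n = (x, d)}"
  have lower: "1 / 8 * (1 / real (Suc m)) \<le> ?u (4 * Suc m)" for m
  proof -
    have odd: "2 * Suc m = Suc (Suc (2 * m))" "4 * Suc m = Suc (Suc (2 * Suc (2 * m)))" by simp_all
    have "?u (4 * Suc m) = srw_prob (2 * Suc m) 0 * srw_prob (Suc (2 * m)) (- 1) / 2"
      using target_prob_in_class[OF \<zeta> d s, where n = "Suc (2 * m)" and ?x0.0 = x] unfolding odd by (simp add: dot_def)
    \<comment> \<open>The last step leads from a neighbour of the origin, which by symmetry may be either one.\<close>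
    also have "srw_prob (Suc (2 * m)) (- 1) = srw_prob (2 * Suc m) 0"
      using srw_prob_minus[of "Suc (2 * m)" 1] unfolding odd srw_prob.simps(2)[of "Suc (2 * m)"] by (simp add: add_divide_distrib)
    also have "srw_prob (2 * Suc m) 0 * srw_prob (2 * Suc m) 0 = (srw_prob (2 * Suc m) 0)\<^sup>2"
      by (rule power2_eq_square[symmetric])
    finally have u: "?u (4 * Suc m) = (srw_prob (2 * Suc m) 0)\<^sup>2 / 2" .
    have "1 / 8 * (1 / real (Suc m)) = 1 / (4 * real (Suc m)) / 2" by simp
    also have "\<dots> \<le> (srw_prob (2 * Suc m) 0)\<^sup>2 / 2"
      by (intro divide_right_mono srw_prob_origin_lower) simp_all
    finally show ?thesis unfolding u .
  qed
  show "\<not> summable ?u"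
  proof
    assume "summable ?u"
    then have "summable (?u \<circ> (\<lambda>m. 4 * Suc m))"
      by (rule summable_reindex) (auto simp: inj_on_def)
    then have "summable (\<lambda>m. 1 / 8 * (1 / real (Suc m)))"
      by (rule summable_comparison_test[rotated]) (use lower in auto)
    then have "summable (\<lambda>m. 1 / real (Suc m))"
      by (subst (asm) summable_cmult_iff) simp
    then show False
      using not_summable_harmonic[where 'a = real] summable_Suc_iff[of "\<lambda>n. 1 / real n"]
      by (simp add: inverse_eq_divide)
  qed
qed


section \<open>Escape from the other states\<close>

text \<open>Visits at time \<open>0\<close> are excluded, so that a sure hit of \<open>t\<close> from \<open>t\<close> itself is recurrence.\<close>
definition sure_hit :: "env \<Rightarrow> state \<Rightarrow> state \<Rightarrow> bool" where
  "sure_hit \<omega> t s \<longleftrightarrow> measure (walk_law \<omega> s) {p. \<exists>n\<in>{0<..}. p n = t} = 1"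

lemma recurrent_iff_sure_hit: "recurrent \<omega> t \<longleftrightarrow> sure_hit \<omega> t t"
proof -
  have "{p \<in> space (walk_law \<omega> t). \<exists>n>0. p n = t} = {p. \<exists>n\<in>{0<..}. p n = t}" by auto
  then show ?thesis by (simp add: recurrent_def return_prob_def sure_hit_def)
qed

text \<open>By the first step, the hitting probability is an average of the hitting probabilities from the
  successors. An average of numbers in \<open>[0, 1]\<close> equals \<open>1\<close> only if each number of positive weight does.
  The successor \<open>t\<close> counts as hit at once, and the assumption on \<open>t\<close> covers this case.\<close>
lemma sure_hit_step:
  assumes env: "environment \<omega>" and d: "d \<in> directions" and d': "d' \<in> directions"
    and t: "sure_hit \<omega> t t" and s: "sure_hit \<omega> t (x, d)" and pos: "\<omega> x d d' > 0"
  shows "sure_hit \<omega> t (x + d', d')"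
proof (cases "(x + d', d') = t")
  case False
  let ?H = "{p :: nat \<Rightarrow> state. \<exists>n\<in>UNIV. p n = t}"
  let ?h = "\<lambda>e. measure (walk_law \<omega> (x + e, e)) ?H"
  have H: "?H \<in> events" by (rule countable_visits_event)
  have le: "?h e \<le> 1" for e
    by (rule prob_space.prob_le_1[OF prob_space_walk_law])
  have nonneg: "0 \<le> \<omega> x d e" if "e \<in> directions" for e
    using env d that unfolding environment_def by blast
  have total: "(\<Sum>e\<in>directions. \<omega> x d e) = 1"
    using env d unfolding environment_def by blast
  have "{p. \<exists>n\<in>{0<..}. p n = t} = {p. (\<lambda>k. p (Suc k)) \<in> ?H}"
    by (auto simp: gr0_conv_Suc)
  then have "(\<Sum>e\<in>directions. \<omega> x d e * ?h e) = 1"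
    using s first_step[OF env d H, of x] by (simp add: sure_hit_def)
  then have "(\<Sum>e\<in>directions. \<omega> x d e * (1 - ?h e)) = 0"
    by (simp add: right_diff_distrib sum_subtractf total)
  then have "\<omega> x d d' * (1 - ?h d') = 0"
    using sum_nonneg_eq_0_iff[of directions "\<lambda>e. \<omega> x d e * (1 - ?h e)"] nonneg le d' by simp
  with pos have "?h d' = 1" by simp
  moreover have "measure (walk_law \<omega> (x + d', d')) {p. \<exists>n\<in>{0<..}. p n = t} = ?h d'"
  proof (rule measure_walk_cong_start[OF countable_visits_event(1) H])
    fix p :: "nat \<Rightarrow> state" assume "p 0 = (x + d', d')"
    with False have "p 0 \<noteq> t" by simp
    then show "p \<in> {p. \<exists>n\<in>{0<..}. p n = t} \<longleftrightarrow> p \<in> ?H"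
      by (auto intro: gr0I)
  qed
  ultimately show ?thesis by (simp add: sure_hit_def)
qed (use t in simp)

lemma recurrent_class_closed:
  assumes \<zeta>: "\<forall>x. \<zeta> x \<in> {0..1}" and s: "(x, d) \<in> recurrent_class" and t: "t \<notin> recurrent_class"
  shows "\<not> sure_hit (zeta_env \<zeta>) t (x, d)"
proof -
  let ?L = "walk_law (zeta_env \<zeta>)"
  interpret L: prob_space "?L (x, d)" by (rule prob_space_walk_law)
  have "measure (?L (x, d)) {p. p n = t} = 0" for n
    using s
  proof (induction n arbitrary: x d)
    case 0
    then show ?case using start_prob[of "zeta_env \<zeta>" "(x, d)" "\<lambda>s. s = t"] t by auto
  next
    case (Suc n)
    have d: "d \<in> directions" using recurrent_class_turns[OF Suc.prems] by blast
    have "(x + perp d, perp d) \<in> recurrent_class" "(x - perp d, - perp d) \<in> recurrent_class"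
      using Suc.prems turn_preserves_class[OF d, of "perp d" x] turn_preserves_class[OF d, of "- perp d" x]
      by simp_all
    from this[THEN Suc.IH] show ?case
      using recurrent_class_first_step[OF \<zeta> Suc.prems, where P = "\<lambda>s. s = t" and n = n] by simp
  qed
  then have "AE p in ?L (x, d). p \<notin> {p. p n = t}" for n
    using coordinate_event[of "\<lambda>s. s = t" n] by (subst L.prob_eq_0[symmetric]) (simp_all add: sets_walk_law)
  then have "AE p in ?L (x, d). \<forall>n. p n \<noteq> t"
    by (subst AE_all_countable) simp
  then have "AE p in ?L (x, d). p \<notin> {p. \<exists>n\<in>{0<..}. p n = t}"
    by eventually_elim simp
  then have "measure (?L (x, d)) {p. \<exists>n\<in>{0<..}. p n = t} = 0"
    using countable_visits_event(1)[of "{0<..}" "\<lambda>s. s = t"]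
    by (subst L.prob_eq_0) (simp_all add: sets_walk_law)
  then show ?thesis by (simp add: sure_hit_def)
qed

text \<open>Even sites have integer coordinates along the two diagonals, and each of the four diagonal
  moves changes one of these coordinates by \<open>\<plusminus>1\<close>.\<close>
lemma even_lattice_connected:
  fixes x y :: vec2
  assumes x: "x \<in> Z2_even" "T x" and y: "y \<in> Z2_even"
    and step: "\<And>x a b. T x \<Longrightarrow> a \<in> {1, -1} \<Longrightarrow> b \<in> {1, -1} \<Longrightarrow> T (x + (a, b))"
  shows "T y"
proof -
  have line: "T (z + (i, i * b))" if z: "T z" and b: "b \<in> {1, -1}" for z and i b :: int
  proof (induction i rule: int_induct[of _ 0])
    case base
    then show ?case using z by (simp flip: zero_prod_def)
  next
    case (step1 i)
    from step[OF step1(2), of 1 b] b show ?case by (simp add: algebra_simps)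
  next
    case (step2 i)
    from step[OF step2(2), of "- 1" "- b"] b show ?case by (auto simp: algebra_simps)
  qed
  define u v where "u = fst y - fst x" and "v = snd y - snd x"
  have "even (u + v)" "even (u - v)" using x(1) y by (auto simp: Z2_even_def u_def v_def)
  then obtain i j where ij: "u + v = 2 * i" "u - v = 2 * j" by (elim evenE)
  have "T (x + (i, i * 1) + (j, j * - 1))"
    by (rule line[OF line[OF x(2)]]) simp_all
  moreover have "x + (i, i * 1) + (j, j * - 1) = y"
    using ij by (auto simp: prod_eq_iff u_def v_def)
  ultimately show ?thesis by simp
qed

text \<open>If the return to the starting state were sure, the hit would be sure from all states that can
  be reached from it, so none of these could lie in the recurrent class. Hence \<open>\<zeta>\<close> would vanish at
  every even site that is reached. But then both turns are possible there, pairs of turns realise all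
  diagonal moves, and \<open>\<zeta>\<close> would vanish at all even sites.\<close>
lemma outside_recurrent_class_non_recurrent:
  assumes \<zeta>: "\<forall>x. \<zeta> x \<in> {0..1}" and pos: "y \<in> Z2_even" "\<zeta> y > 0"
    and d0: "d0 \<in> directions" and t: "(x0, d0) \<notin> recurrent_class"
  shows "non_recurrent (zeta_env \<zeta>) (x0, d0)"
proof (rule ccontr)
  let ?\<omega> = "zeta_env \<zeta>"
  let ?S = "\<lambda>x d. sure_hit ?\<omega> (x0, d0) (x, d)"
  note env = zeta_environment[OF \<zeta>]
  assume "\<not> non_recurrent ?\<omega> (x0, d0)"
  moreover have "return_prob ?\<omega> (x0, d0) \<le> 1"
    unfolding return_prob_def by (rule prob_space.prob_le_1[OF prob_space_walk_law])
  ultimately have "recurrent ?\<omega> (x0, d0)"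
    unfolding non_recurrent_def recurrent_def by linarith
  then have start: "?S x0 d0" by (simp add: recurrent_iff_sure_hit)
  note step = sure_hit_step[OF env _ _ start]
  have outside: "(x, d) \<notin> recurrent_class" if "?S x d" for x d
    using recurrent_class_closed[OF \<zeta> _ t] that by blast
  have zero: "\<zeta> x = 0" if S: "?S x d" and may: "may_go_straight x d" for x d
  proof (rule ccontr)
    note d = may_go_straight_direction[OF may]
    assume "\<zeta> x \<noteq> 0"
    with \<zeta>[rule_format, of x] have "\<zeta> x > 0" by simp
    moreover have "zeta_env \<zeta> x d d = \<zeta> x"
      using zeta_env_even_NS(1)[of x d \<zeta>] may by (simp add: may_go_straight_def Forward_def)
    ultimately have "?S (x + d) d" using step[OF d d S] by simp
    with outside straight_enters_class[OF may] show False by blast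
  qed
  have turn: "?S (x + d') d'" if S: "?S x d" and d: "d \<in> directions" and d': "d' \<in> {perp d, - perp d}"
    for x d d'
  proof (rule step[OF d _ S])
    show "d' \<in> directions"
      using d' perp_directions(1)[OF d] perp_directions(2)[of "perp d"] by blast
    show "zeta_env \<zeta> x d d' > 0"
    proof (cases "may_go_straight x d")
      case True
      with zeta_env_even_NS(2,3)[of x d \<zeta>] zero[OF S True] d' show ?thesis
        by (auto simp: may_go_straight_def Left_def Right_def)
    next
      case False
      with d have "x \<in> Z2_even \<and> d \<in> {West, East} \<or> x \<in> Z2_odd \<and> d \<in> directions"
        by (auto simp: may_go_straight_def Z2_odd_def directions_def West_def South_def)
      from zeta_env_otherwise(2,3)[OF this, of \<zeta>] d' show ?thesis
        by (auto simp: Left_def Right_def)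
    qed
  qed
  have perps: "perp North = - East" "perp (- North) = East" "perp East = North" "perp (- East) = - North"
    by (simp_all add: perp_def North_def East_def)
  have compass_dirs: "North \<in> directions" "- North \<in> directions" "East \<in> directions" "- East \<in> directions"
    by (simp_all add: directions_def)
  \<comment> \<open>A turn into \<open>\<plusminus>East\<close> followed by a turn into \<open>\<plusminus>North\<close> is a diagonal move between even sites.\<close>
  let ?T = "\<lambda>x. x \<in> Z2_even \<and> (?S x North \<or> ?S x (- North))"
  have T_step: "?T (x + (a, b))" if T: "?T x" and a: "a \<in> {1, - 1}" and b: "b \<in> {1, - 1}" for x a b
  proof -
    have "?S (x + East) East" "?S (x + - East) (- East)"
      using T turn[of x North East] turn[of x North "- East"]
        turn[of x "- North" East] turn[of x "- North" "- East"]
      by (auto simp only: perps compass_dirs minus_minus)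
    then have "?S (x + (a, 0)) (a, 0)"
      using a by (auto simp: East_def)
    moreover have "(a, 0) \<in> directions" "(0, b) \<in> {perp (a, 0), - perp (a, 0)}"
      using a b by (auto simp: directions_def East_def perp_def)
    ultimately have "?S (x + (a, 0) + (0, b)) (0, b)" by (rule turn)
    moreover have "x + (a, b) \<in> Z2_even" using T a b by (auto simp: Z2_even_def)
    ultimately show ?thesis using b by (auto simp: North_def add.assoc)
  qed
  have "\<exists>x. ?T x"
  proof (cases "x0 \<in> Z2_even")
    case True
    then have "d0 \<in> {North, South}"
      using t d0 by (auto simp: recurrent_class_def directions_def West_def South_def)
    then show ?thesis using start True by (intro exI[of _ x0]) (auto simp: South_def)
  next
    case False
    then have "d0 \<in> {East, - East}"
      using t d0 by (auto simp: recurrent_class_def Z2_odd_def directions_def West_def South_def)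
    then have "North \<in> {perp d0, - perp d0}" by (auto simp: perps)
    then have "?S (x0 + North) North" by (rule turn[OF start d0])
    moreover have "x0 + North \<in> Z2_even" using False by (auto simp: Z2_even_def North_def)
    ultimately show ?thesis by blast
  qed
  then obtain x where x: "?T x" by blast
  have "?T y"
    by (rule even_lattice_connected[OF _ x pos(1) T_step]) (use x in auto)
  then obtain d where "?S y d" "d \<in> {North, - North}" by blast
  with zero[of y d] pos show False by (simp add: may_go_straight_def South_def)
qed

section \<open>Zero velocity\<close>

text \<open>In the exponential moment bound, a step that goes straight costs a factor \<open>exp \<theta>\<close>. This happens
  at most once, when the walk enters the recurrent class, and the weight pays for it.\<close>
definition weight :: "real \<Rightarrow> vec2 \<Rightarrow> vec2 \<Rightarrow> vec2 \<Rightarrow> real" where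
  "weight \<theta> u x d = exp (\<theta> * dot u x) * (if (x, d) \<in> recurrent_class then 1 else exp \<theta>)"

lemma dot_directions: "u \<in> directions \<Longrightarrow> d \<in> directions \<Longrightarrow> \<bar>dot u d\<bar> \<le> 1"
  unfolding directions_def by (elim insertE emptyE) (simp_all add: dot_def East_def North_def)

lemma cosh_le_of_abs_le: "\<bar>a\<bar> \<le> b \<Longrightarrow> cosh a \<le> cosh b" for a b :: real
  by (metis abs_ge_zero cosh_real_abs cosh_real_nonneg_le_iff order_trans)

lemma weight_turn:
  assumes \<theta>: "\<theta> \<ge> 0" and u: "u \<in> directions" and d: "d \<in> directions"
  shows "(weight \<theta> u (x + perp d) (perp d) + weight \<theta> u (x + - perp d) (- perp d)) / 2
    \<le> cosh \<theta> * weight \<theta> u x d"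
proof -
  let ?K = "if (x, d) \<in> recurrent_class then 1 else exp \<theta>"
  let ?c = "\<theta> * real_of_int (dot u (perp d))"
  have "weight \<theta> u (x + perp d) (perp d) = exp (\<theta> * dot u x) * exp ?c * ?K"
    using turn_preserves_class[OF d, of "perp d" x]
    by (simp add: weight_def dot_add ring_distribs exp_add)
  moreover have "weight \<theta> u (x + - perp d) (- perp d) = exp (\<theta> * dot u x) * exp (- ?c) * ?K"
    using turn_preserves_class[OF d, of "- perp d" x]
    by (simp add: weight_def dot_add ring_distribs exp_diff exp_minus divide_inverse)
  ultimately have "(weight \<theta> u (x + perp d) (perp d) + weight \<theta> u (x + - perp d) (- perp d)) / 2
      = exp (\<theta> * dot u x) * ?K * cosh ?c"
    by (simp add: cosh_field_def field_simps)
  also have "cosh ?c \<le> cosh \<theta>"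
  proof (rule cosh_le_of_abs_le)
    have "\<bar>real_of_int (dot u (perp d))\<bar> \<le> 1"
      using dot_directions[OF u perp_directions(1)[OF d]] by linarith
    then show "\<bar>?c\<bar> \<le> \<theta>" using \<theta> by (simp add: abs_mult mult_left_le)
  qed
  then have "exp (\<theta> * dot u x) * ?K * cosh ?c \<le> exp (\<theta> * dot u x) * ?K * cosh \<theta>"
    by (intro mult_left_mono) auto
  finally show ?thesis by (simp add: weight_def mult.commute mult.left_commute)
qed

lemma weight_step:
  assumes \<zeta>: "\<forall>x. \<zeta> x \<in> {0..1}" and \<theta>: "\<theta> \<ge> 0" and u: "u \<in> directions" and d: "d \<in> directions"
  shows "(\<Sum>d'\<in>directions. zeta_env \<zeta> x d d' * weight \<theta> u (x + d') d') \<le> cosh \<theta> * weight \<theta> u x d"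
proof (cases "may_go_straight x d")
  case False
  then show ?thesis
    using weight_turn[OF \<theta> u d, of x] turn_sum[OF d False, of \<zeta> "\<lambda>d'. weight \<theta> u (x + d') d'"] by simp
next
  case True
  have "weight \<theta> u (x + d) d = exp (\<theta> * dot u x) * exp (\<theta> * dot u d)"
    using straight_enters_class[OF True] by (simp add: weight_def dot_add ring_distribs exp_add)
  also have "\<dots> \<le> exp (\<theta> * dot u x) * exp \<theta>"
  proof -
    have "real_of_int (dot u d) \<le> 1" using dot_directions[OF u d] by linarith
    then show ?thesis using \<theta> by (simp add: mult_left_le)
  qed
  also have "\<dots> = weight \<theta> u x d"
    using recurrent_class_turns[of x d] True by (auto simp: weight_def)
  also have "\<dots> \<le> cosh \<theta> * weight \<theta> u x d"
    using cosh_real_ge_1[of \<theta>] by (simp add: weight_def)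
  finally have straight: "weight \<theta> u (x + d) d \<le> cosh \<theta> * weight \<theta> u x d" .
  have "\<zeta> x * weight \<theta> u (x + d) d
      + (1 - \<zeta> x) * ((weight \<theta> u (x + perp d) (perp d) + weight \<theta> u (x + - perp d) (- perp d)) / 2)
      \<le> \<zeta> x * (cosh \<theta> * weight \<theta> u x d) + (1 - \<zeta> x) * (cosh \<theta> * weight \<theta> u x d)"
    using \<zeta>[rule_format, of x] by (intro add_mono mult_left_mono straight weight_turn[OF \<theta> u d]) auto
  then show ?thesis
    unfolding straight_sum[OF d True, of \<zeta> "\<lambda>d'. weight \<theta> u (x + d') d'"] by (simp add: algebra_simps)
qed

text \<open>This is Markov's inequality for the exponential moment, with the estimate of the moment and of
  the probability carried out in a single induction over the first step.\<close>
lemma displacement_tail: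
  fixes c :: real
  assumes \<zeta>: "\<forall>x. \<zeta> x \<in> {0..1}" and \<theta>: "\<theta> \<ge> 0" and u: "u \<in> directions" and d: "d \<in> directions"
  shows "measure (walk_law (zeta_env \<zeta>) (x, d)) {p. c \<le> dot u (fst (p n))}
    \<le> weight \<theta> u x d * cosh \<theta> ^ n * exp (- \<theta> * c)"
  using d
proof (induction n arbitrary: x d)
  case 0
  have "1 \<le> weight \<theta> u x d * exp (- \<theta> * c)" if "c \<le> dot u x"
  proof -
    have "1 \<le> exp (\<theta> * dot u x) * exp (- \<theta> * c)"
      using mult_left_mono[OF that \<theta>] by (simp flip: exp_add)
    also have "\<dots> \<le> weight \<theta> u x d * exp (- \<theta> * c)"
      using \<theta> by (simp add: weight_def)
    finally show ?thesis .
  qed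
  then show ?case
    using start_prob[of "zeta_env \<zeta>" "(x, d)" "\<lambda>s. c \<le> dot u (fst s)"] by (simp add: weight_def)
next
  case (Suc n)
  have nonneg: "0 \<le> zeta_env \<zeta> x d d'" if "d' \<in> directions" for d'
    using zeta_environment[OF \<zeta>] Suc.prems that unfolding environment_def by blast
  have "measure (walk_law (zeta_env \<zeta>) (x, d)) {p. c \<le> dot u (fst (p (Suc n)))}
      = (\<Sum>d'\<in>directions. zeta_env \<zeta> x d d'
          * measure (walk_law (zeta_env \<zeta>) (x + d', d')) {p. c \<le> dot u (fst (p n))})"
    by (rule first_step_coordinate[OF zeta_environment[OF \<zeta>] Suc.prems])
  also have "\<dots> \<le> (\<Sum>d'\<in>directions. zeta_env \<zeta> x d d'
          * (weight \<theta> u (x + d') d' * cosh \<theta> ^ n * exp (- \<theta> * c)))"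
    by (intro sum_mono mult_left_mono Suc.IH nonneg)
  also have "\<dots> = (\<Sum>d'\<in>directions. zeta_env \<zeta> x d d' * weight \<theta> u (x + d') d')
      * (cosh \<theta> ^ n * exp (- \<theta> * c))"
    by (simp add: sum_distrib_right mult.assoc)
  also have "\<dots> \<le> cosh \<theta> * weight \<theta> u x d * (cosh \<theta> ^ n * exp (- \<theta> * c))"
    by (intro mult_right_mono weight_step[OF \<zeta> \<theta> u Suc.prems]) simp
  finally show ?case by (simp add: mult_ac)
qed

lemma cosh_lt_exp:
  assumes "\<epsilon> > 0"
  obtains \<theta> :: real where "\<theta> \<ge> 0" "cosh \<theta> * exp (- \<theta> * \<epsilon>) < 1"
proof
  \<comment> \<open>Since \<open>cosh \<theta> \<le> 1 + \<theta>\<^sup>2\<close> for \<open>0 \<le> \<theta> \<le> 1\<close>, it is enough that \<open>\<theta> * \<epsilon> \<ge> 2 * \<theta>\<^sup>2\<close>.\<close>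
  define \<theta> where "\<theta> = min 1 (\<epsilon> / 2)"
  have \<theta>: "0 < \<theta>" "\<theta> \<le> 1" "2 * \<theta> \<le> \<epsilon>" using assms by (auto simp: \<theta>_def)
  show "\<theta> \<ge> 0" using \<theta> by simp
  have "exp \<theta> \<le> 1 + \<theta> + \<theta>\<^sup>2" using exp_bound[of \<theta>] \<theta> by simp
  moreover have "exp (- \<theta>) \<le> 1 - \<theta> + \<theta>\<^sup>2"
  proof -
    have "exp (- \<theta>) \<le> 1 / (1 + \<theta>)"
      using exp_ge_add_one_self[of \<theta>] \<theta> by (simp add: exp_minus inverse_eq_divide frac_le)
    also have "\<dots> \<le> 1 - \<theta> + \<theta>\<^sup>2"
    proof -
      have "(1 - \<theta> + \<theta>\<^sup>2) * (1 + \<theta>) = 1 + \<theta> ^ 3" by (simp add: algebra_simps power2_eq_square power3_eq_cube)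
      then have "1 \<le> (1 - \<theta> + \<theta>\<^sup>2) * (1 + \<theta>)" using \<theta> by simp
      then show ?thesis using \<theta> by (simp add: divide_le_eq)
    qed
    finally show ?thesis .
  qed
  ultimately have "cosh \<theta> \<le> 1 + \<theta>\<^sup>2" by (simp add: cosh_field_def)
  also have "\<dots> < exp (2 * \<theta>\<^sup>2)"
    using exp_ge_add_one_self[of "2 * \<theta>\<^sup>2"] \<theta> by (smt (verit) zero_less_power)
  also have "2 * \<theta>\<^sup>2 \<le> \<theta> * \<epsilon>" using \<theta> by (simp add: power2_eq_square)
  finally have "cosh \<theta> < exp (\<theta> * \<epsilon>)" by simp
  then show "cosh \<theta> * exp (- \<theta> * \<epsilon>) < 1" by (simp add: exp_minus field_simps)
qed

text \<open>By \<open>displacement_tail\<close>, the exceptional events have geometrically decaying probabilities once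
  \<open>\<theta>\<close> is chosen as in \<open>cosh_lt_exp\<close>, and Borel--Cantelli applies.\<close>
lemma displacement_sublinear:
  assumes \<zeta>: "\<forall>x. \<zeta> x \<in> {0..1}" and u: "u \<in> directions" and d: "d \<in> directions" and \<epsilon>: "\<epsilon> > 0"
  shows "AE p in walk_law (zeta_env \<zeta>) (x, d). eventually (\<lambda>n. dot u (fst (p n)) < \<epsilon> * real n) sequentially"
proof -
  let ?L = "walk_law (zeta_env \<zeta>) (x, d)"
  let ?A = "\<lambda>n. {p :: nat \<Rightarrow> state. \<epsilon> * real n \<le> dot u (fst (p n))}"
  interpret L: prob_space ?L by (rule prob_space_walk_law)
  obtain \<theta> where \<theta>: "\<theta> \<ge> 0" "cosh \<theta> * exp (- \<theta> * \<epsilon>) < 1" using cosh_lt_exp[OF \<epsilon>] .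
  have "summable (\<lambda>n. weight \<theta> u x d * (cosh \<theta> * exp (- \<theta> * \<epsilon>)) ^ n)"
    using \<theta>(2) cosh_real_nonneg[of \<theta>] by (intro summable_mult summable_geometric) (simp add: abs_mult)
  then have "summable (\<lambda>n. measure ?L (?A n))"
  proof (rule summable_comparison_test[rotated], intro exI allI impI)
    fix n
    have "weight \<theta> u x d * cosh \<theta> ^ n * exp (- \<theta> * (\<epsilon> * real n))
        = weight \<theta> u x d * (cosh \<theta> * exp (- \<theta> * \<epsilon>)) ^ n"
      by (simp add: power_mult_distrib exp_of_nat_mult[symmetric] mult_ac)
    note power = this
    show "norm (measure ?L (?A n)) \<le> weight \<theta> u x d * (cosh \<theta> * exp (- \<theta> * \<epsilon>)) ^ n"
      using displacement_tail[OF \<zeta> \<theta>(1) u d, where x = x and c = "\<epsilon> * real n" and n = n]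
      unfolding power by simp
  qed
  then have "AE p in ?L. eventually (\<lambda>n. p \<in> space ?L - ?A n) sequentially"
    by (intro borel_cantelli_AE1)
       (auto simp: sets_walk_law intro!: coordinate_event[of "\<lambda>s. _ \<le> real_of_int (dot u (fst s))"]
         L.emeasure_finite[THEN less_top[THEN iffD1]])
  then show ?thesis
    by eventually_elim (auto elim!: eventually_mono simp: not_le)
qed

lemma zeta_env_zero_velocity:
  assumes \<zeta>: "\<forall>x. \<zeta> x \<in> {0..1}" and d: "d \<in> directions"
  shows "zero_velocity (zeta_env \<zeta>) (x, d)"
proof -
  let ?L = "walk_law (zeta_env \<zeta>) (x, d)"
  have "AE p in ?L. \<forall>j. \<forall>u\<in>directions.
      eventually (\<lambda>n. dot u (fst (p n)) < 1 / real (Suc j) * real n) sequentially"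
    unfolding AE_all_countable
    by (intro allI AE_finite_allI finite_directions displacement_sublinear[OF \<zeta> _ d]) auto
  then have "AE p in ?L. (\<lambda>n. (1 / real n) *\<^sub>R to_real2 (fst (p n))) \<longlonglongrightarrow> 0"
  proof eventually_elim
    case (elim p)
    have lim: "(\<lambda>n. real_of_int (a n) / real n) \<longlonglongrightarrow> 0"
      if up: "\<And>n. dot u (fst (p n)) = a n" and u: "u \<in> directions" for u and a :: "nat \<Rightarrow> int"
    proof (rule tendstoI)
      fix e :: real assume "e > 0"
      then obtain j where j: "1 / real (Suc j) < e" using nat_approx_posE by blast
      have down: "dot (- u) (fst (p n)) = - a n" for n
        using up[of n] by (simp add: dot_def)
      have "eventually (\<lambda>n. dot u (fst (p n)) < 1 / real (Suc j) * real n) sequentially"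
        "eventually (\<lambda>n. dot (- u) (fst (p n)) < 1 / real (Suc j) * real n) sequentially"
        using elim u perp_directions(2)[OF u] by blast+
      with eventually_gt_at_top[of 0]
      show "eventually (\<lambda>n. dist (real_of_int (a n) / real n) 0 < e) sequentially"
      proof eventually_elim
        case (elim n)
        then have "\<bar>real_of_int (a n)\<bar> < 1 / real (Suc j) * real n" unfolding up down by simp
        also have "\<dots> \<le> e * real n" using j by (intro mult_right_mono) auto
        finally show ?case using elim(1) by (simp add: dist_real_def abs_divide divide_less_eq)
      qed
    qed
    have "dot East (fst (p n)) = fst (fst (p n))" "dot North (fst (p n)) = snd (fst (p n))" for n
      by (simp_all add: dot_def East_def North_def)
    then have "(\<lambda>n. (real_of_int (fst (fst (p n))) / real n, real_of_int (snd (fst (p n))) / real n))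
        \<longlonglongrightarrow> (0, 0)"
      by (intro tendsto_Pair lim) (auto simp: directions_def)
    then show ?case by (simp add: to_real2_def zero_prod_def)
  qed
  then show ?thesis unfolding zero_velocity_def .
qed

theorem proposition4p2:
  fixes \<zeta> :: "int \<times> int \<Rightarrow> real" and x0 d0 :: "int \<times> int"
  assumes "\<And>x. \<zeta> x \<in> {0..1}"
    and "\<exists>x\<in>Z2_even. \<zeta> x > 0"
    and "d0 \<in> directions"
  shows "(if x0 \<in> Z2_even \<and> d0 \<in> {East, West} \<or> x0 \<in> Z2_odd \<and> d0 \<in> {North, South}
          then recurrent (zeta_env \<zeta>) (x0, d0)
          else non_recurrent (zeta_env \<zeta>) (x0, d0))
       \<and> zero_velocity (zeta_env \<zeta>) (x0, d0)"
proof -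
  have \<zeta>: "\<forall>x. \<zeta> x \<in> {0..1}" using assms(1) by blast
  have iff: "(x0, d0) \<in> recurrent_class \<longleftrightarrow>
      x0 \<in> Z2_even \<and> d0 \<in> {East, West} \<or> x0 \<in> Z2_odd \<and> d0 \<in> {North, South}"
    by (simp add: recurrent_class_def)
  obtain y where "y \<in> Z2_even" "\<zeta> y > 0" using assms(2) by blast
  then show ?thesis
    unfolding iff[symmetric]
    using recurrent_class_recurrent[OF \<zeta>, of x0 d0] zeta_env_zero_velocity[OF \<zeta> assms(3), of x0]
      outside_recurrent_class_non_recurrent[OF \<zeta> _ _ assms(3), of y x0]
    by (cases "(x0, d0) \<in> recurrent_class") simp_all
qed

end
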